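(* Let $\mathrm{C}$ be a configuration of $15$ lines with $15$ intersection points in $\mathbb{P}^4$ which is not contained in $\mathbb{P}^3$ and is combinatorially isomorphic to the Cremona--Richmond configuration. Then it is projectively isomorphic to the Cremona--Richmond configuration.
   Context: The base field is algebraically closed of characteristic zero. The Cremona--Richmond configuration $\mathrm{CR}$ lies in $\mathbb{P}^4=\{x_1+\dots+x_6=0\}\subset\mathbb{P}^5$. Its $15$ lines are indexed by splittings of $\{1,\dots,6\}$ into three pairs $I_1\sqcup I_2\sqcup I_3$; the corresponding line $\mathrm{L}_{(I_1|I_2|I_3)}$ is given by $x_i=x_j$ whenever $\{i,j\}=I_p$ for some $p$. Its $15$ points $\mathrm{P}_I$ are indexed by two-element subsets $I\subset\{1,\dots,6\}$ and given by $x_i=x_j$ whenever $i,j\in I$ or $i,j\in\{1,\dots,6\}\setminus I$ (e.g. $\mathrm{P}_{1,2}=(2:2:-1:-1:-1:-1)$). The point $\mathrm{P}_I$ lies on $\mathrm{L}_{(I_1|I_2|I_3)}$ if and only if $I\in\{I_1,I_2,I_3\}$, and the $\mathrm{P}_I$ are the only intersection points of the lines. "Combinatorially isomorphic" means that there are bijections between the sets of lines and between the sets of intersection points preserving incidence; "not contained in $\mathbb{P}^3$" means not contained in a hyperplane of $\mathbb{P}^4$. *)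

theory Defs
  imports "HOL-Analysis.Analysis" "HOL-Library.Disjoint_Sets"
begin

text \<open>
  The projective space of a vector space is handled through linear subspaces: a point is a
  subspace of dimension 1, a line a subspace of dimension 2, a hyperplane of a
  projective 4-space a subspace of dimension 4, and incidence is inclusion. The coordinates
  \<open>x\<^sub>1, \<dots>, x\<^sub>6\<close> are indexed by the six-element type \<open>6\<close> (in which \<open>6 = 0\<close>).
\<close>

definition sum_zero :: "('k::field ^ 6) set" where
  "sum_zero = {x. (\<Sum>i\<in>UNIV. x $ i) = 0}"

definition line_in_P4 :: "('k::field ^ 6) set \<Rightarrow> bool" where
  "line_in_P4 L \<longleftrightarrow> vec.subspace L \<and> L \<subseteq> sum_zero \<and> vec.dim L = 2"

text \<open>Two distinct lines meet iff their subspaces intersect in dimension 1.\<close>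

definition intersection_points :: "('k::field ^ 6) set set \<Rightarrow> ('k ^ 6) set set" where
  "intersection_points C = {L \<inter> M |L M. L \<in> C \<and> M \<in> C \<and> L \<noteq> M \<and> vec.dim (L \<inter> M) = 1}"

definition contained_in_P3 :: "('k::field ^ 6) set set \<Rightarrow> bool" where
  "contained_in_P3 C \<longleftrightarrow>
    (\<exists>W. vec.subspace W \<and> W \<subseteq> sum_zero \<and> vec.dim W = 4 \<and> (\<forall>L\<in>C. L \<subseteq> W))"

definition splittings :: "6 set set set" where
  "splittings = {S. partition_on UNIV S \<and> (\<forall>I\<in>S. card I = 2)}"

definition CR_line :: "6 set set \<Rightarrow> ('k::field ^ 6) set" where
  "CR_line S = {x \<in> sum_zero. \<forall>I\<in>S. \<forall>i\<in>I. \<forall>j\<in>I. x $ i = x $ j}"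

definition CR_point :: "6 set \<Rightarrow> ('k::field ^ 6) set" where
  "CR_point I = {x \<in> sum_zero. \<forall>i j. (i \<in> I \<and> j \<in> I) \<or> (i \<notin> I \<and> j \<notin> I) \<longrightarrow> x $ i = x $ j}"

definition CR_lines :: "('k::field ^ 6) set set" where
  "CR_lines = CR_line ` splittings"

definition CR_points :: "('k::field ^ 6) set set" where
  "CR_points = CR_point ` {I. card I = 2}"

definition combinatorially_isomorphic ::
  "('k::field ^ 6) set set \<Rightarrow> ('k ^ 6) set set \<Rightarrow> ('k ^ 6) set set \<Rightarrow> ('k ^ 6) set set \<Rightarrow> bool" where
  "combinatorially_isomorphic lines points lines' points' \<longleftrightarrow>
    (\<exists>\<phi> \<psi>. bij_betw \<phi> lines lines' \<and> bij_betw \<psi> points points' \<and>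
      (\<forall>L\<in>lines. \<forall>P\<in>points. P \<subseteq> L \<longleftrightarrow> \<psi> P \<subseteq> \<phi> L))"

text \<open>
  A projective automorphism of the hyperplane \<^const>\<open>sum_zero\<close> is induced by a linear automorphism of
  that subspace, which is always the restriction of a linear map of the ambient space.
\<close>

definition projectively_isomorphic ::
  "('k::field ^ 6) set set \<Rightarrow> ('k ^ 6) set set \<Rightarrow> ('k ^ 6) set set \<Rightarrow> ('k ^ 6) set set \<Rightarrow> bool" where
  "projectively_isomorphic lines points lines' points' \<longleftrightarrow>
    (\<exists>f. Vector_Spaces.linear (*s) (*s) f \<and> bij_betw f sum_zero sum_zero \<and>
      (\<lambda>L. f ` L) ` lines = lines' \<and> (\<lambda>P. f ` P) ` points = points')"

end

theory Submission
  imports Defs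
begin

text \<open>
  The fifteen points of the configuration are labelled by the duads (two-element subsets) of
  \<open>{1, \<dots>, 6}\<close> and the lines by the partitions into three duads, so all projective information is in
  vectors \<open>w I\<close> spanning the points, subject to one linear relation for each line. On the model,
  \<open>cr_vec I\<close> takes the value 2 on \<open>I\<close> and -1 elsewhere, and each of these relations says that the three
  vectors sum to zero. What has to be shown is that any other solution \<open>w\<close> of the fifteen relations that
  spans the 5-dimensional space \<^const>\<open>sum_zero\<close> becomes \<open>cr_vec\<close> after rescaling the single vectors and
  applying a linear map (lemma \<open>collinear_triples_normal_form\<close>).

  Remove one label \<open>z\<close> and arrange the other five in a cycle \<open>p 0, \<dots>, p 4\<close>. This splits the duads
  into three orbits of the cyclic rotation: the sides \<open>a j = {p j, p (j + 1)}\<close>, the spokes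
  \<open>b j = {p j, z}\<close>, and the diagonals \<open>c j = {p (j + 1), p (j + 4)}\<close>. The lines split likewise: \<open>b j\<close>
  lies with \<open>a (j + 1)\<close> and \<open>a (j + 3)\<close>, \<open>c j\<close> lies with \<open>b j\<close> and \<open>a (j + 2)\<close>, and \<open>b (j + 3)\<close> lies
  with \<open>c j\<close> and \<open>c (j + 1)\<close>. By the first two kinds of lines the sides generate everything (lemma
  \<open>pentagon_spans\<close>); since the configuration is not in a hyperplane, the five vectors of the sides are a
  basis. In this basis, up to scalars,

    \<open>b j = a (j + 1) + B j * a (j + 3)\<close> and
    \<open>c j = a (j + 1) + G j * a (j + 2) + B j * a (j + 3)\<close>.

  The third kind of lines forces \<open>B j = G j * G (j + 1)\<close> and makes the product of the five \<open>G j\<close> equal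
  to -1 (lemma \<open>pentagon_cocycle\<close>). Rescaling the basis changes the \<open>G j\<close> arbitrarily subject to this
  product, so that all of them can be made equal to -1 (lemma \<open>pentagon_normal_form\<close>). No parameter is
  left. The model satisfies the same relations, hence has the same normal form, and sending one rescaled
  basis to the other is the required projective isomorphism.
\<close>

section \<open>Indices modulo five\<close>

lemma exhaust_5: fixes x :: 5 shows "x = 0 \<or> x = 1 \<or> x = 2 \<or> x = 3 \<or> x = 4"
proof (induct x)
  case (of_int z)
  hence "0 \<le> z" and "z < 5" by simp_all
  hence "z = 0 \<or> z = 1 \<or> z = 2 \<or> z = 3 \<or> z = 4" by arith
  thus ?case by auto
qed

lemma UNIV_5: "(UNIV :: 5 set) = {0, 1, 2, 3, 4}"
  using exhaust_5 by auto

lemma sum_5_shift: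
  fixes f :: "5 \<Rightarrow> 'a::comm_monoid_add"
  shows "sum f UNIV = f j + f (j + 1) + f (j + 2) + f (j + 3) + f (j + 4)"
proof -
  have "bij (\<lambda>i::5. j + i)"
    by (rule bij_betwI[where g = "\<lambda>i. i - j"]) auto
  then have "sum f UNIV = (\<Sum>i\<in>UNIV. f (j + i))"
    using sum.reindex_bij_betw[of "\<lambda>i. j + i" UNIV UNIV f] by simp
  also have "\<dots> = f j + f (j + 1) + f (j + 2) + f (j + 3) + f (j + 4)"
    unfolding UNIV_5 by (simp add: ac_simps)
  finally show ?thesis .
qed

lemma cyclic_5_simps:
  fixes j :: 5
  shows "j + 1 + 1 = j + 2" "j + 1 + 3 = j + 4" "j + 1 + 4 = j" "j + 3 + 1 = j + 4"
    "j + 3 + 3 = j + 1" "j + 4 + 1 = j" "j + 4 + 4 = j + 3"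
  by (simp_all add: add.assoc)

section \<open>The hyperplane of vectors with coordinate sum zero\<close>

lemma subspace_sum_zero: "vec.subspace sum_zero"
  by (auto simp: vec.subspace_def sum_zero_def sum.distrib simp flip: sum_distrib_left)

lemma dim_sum_zero: "vec.dim (sum_zero :: ('k::field_char_0 ^ 6) set) = 5"
proof (rule antisym)
  let ?e = "axis 1 1 :: 'k ^ 6"
  have sub: "vec.subspace (sum_zero :: ('k ^ 6) set)"
    by (rule subspace_sum_zero)
  have nin: "?e \<notin> sum_zero"
    by (simp add: sum_zero_def axis_def)
  then have "vec.span sum_zero \<subset> vec.span (UNIV :: ('k^6) set)"
    using sub by (metis UNIV_I psubsetI subset_UNIV vec.span_UNIV vec.span_eq_iff)
  from vec.dim_psubset[OF this] show "vec.dim (sum_zero :: ('k ^ 6) set) \<le> 5"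
    by (simp add: vec_dim_card del: vec.dim_UNIV)
  have "x \<in> vec.span (insert ?e sum_zero)" for x
  proof -
    have "x - (\<Sum>i\<in>UNIV. x $ i) *s ?e \<in> sum_zero"
    proof -
      have "(\<Sum>i\<in>UNIV. ?e $ i) = 1"
        by (simp add: axis_def)
      then show ?thesis
        by (simp add: sum_zero_def sum_subtractf flip: sum_distrib_left)
    qed
    then show ?thesis
      unfolding vec.span_breakdown_eq by (blast intro: vec.span_base)
  qed
  then have "vec.span (insert ?e sum_zero) = UNIV" by blast
  then have "vec.dim (insert ?e sum_zero) = 6"
    using vec.dim_span[of "insert ?e sum_zero"] by (simp add: vec_dim_card del: vec.dim_UNIV vec.dim_span)
  then show "5 \<le> vec.dim (sum_zero :: ('k ^ 6) set)"
    by (simp add: vec.dim_insert split: if_splits)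
qed

text \<open>
  Five vectors spanning the 5-dimensional hyperplane form a basis of it. This serves twice: for the sides
  of the pentagon, and for their images in the model.
\<close>

lemma spanning_family_5:
  fixes g :: "5 \<Rightarrow> 'k::field_char_0 ^ 6"
  assumes span: "vec.span (range g) = sum_zero"
  shows "vec.independent (range g)" "inj g"
proof -
  have "5 \<le> card (range g)"
    using vec.dim_le_card[of sum_zero "range g"] span by (simp add: dim_sum_zero)
  moreover have "card (range g) \<le> 5"
    using card_image_le[of "UNIV :: 5 set" g] by simp
  ultimately have card: "card (range g) = 5"
    by simp
  then show "inj g"
    by (intro eq_card_imp_inj_on) simp_all
  show "vec.independent (range g)"
    using card span vec.span_superset[of "range g"]
    by (intro vec.card_le_dim_spanning[of _ sum_zero]) (simp_all add: dim_sum_zero)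
qed

text \<open>
  The points of a degenerate configuration may span any smaller dimension, whereas a hyperplane has
  dimension exactly 4; a basis of their span is enlarged inside a basis of \<^const>\<open>sum_zero\<close>.
\<close>

lemma subspace_in_hyperplane:
  fixes U :: "('k::field_char_0 ^ 6) set"
  assumes "vec.subspace U" "U \<subseteq> sum_zero" "U \<noteq> sum_zero"
  obtains W where "vec.subspace W" "U \<subseteq> W" "W \<subseteq> sum_zero" "vec.dim W = 4"
proof -
  have "vec.dim U \<le> 4"
  proof (rule ccontr)
    assume "\<not> vec.dim U \<le> 4"
    then have "vec.dim (sum_zero :: ('k ^ 6) set) \<le> vec.dim U"
      by (simp add: dim_sum_zero)
    then show False
      using vec.subspace_dim_equal[OF assms(1) subspace_sum_zero assms(2)] assms(3) by blast
  qed
  moreover obtain D where D: "D \<subseteq> U" "vec.independent D" "U \<subseteq> vec.span D" "card D = vec.dim U"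
    by (rule vec.basis_exists)
  moreover obtain E where E: "D \<subseteq> E" "E \<subseteq> sum_zero" "vec.independent E" "sum_zero \<subseteq> vec.span E"
    using vec.maximal_independent_subset_extend[of D sum_zero] D(1,2) assms(2) by blast
  moreover have "card E = 5"
    using E vec.basis_card_eq_dim[of E sum_zero] by (simp add: dim_sum_zero)
  moreover have "finite E"
    using E(3) by (rule vec.finiteI_independent)
  ultimately obtain F where F: "D \<subseteq> F" "F \<subseteq> E" "card F = 4"
    using exists_subset_between[of D 4 E] by auto
  show thesis
  proof
    show "vec.subspace (vec.span F)"
      by (rule vec.subspace_span)
    show "U \<subseteq> vec.span F"
      using D(3) F(1) vec.span_mono by blast
    show "vec.span F \<subseteq> sum_zero"
      using F(2) E(2) by (intro vec.span_minimal subspace_sum_zero) blast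
    show "vec.dim (vec.span F) = 4"
      using vec.dim_span_eq_card_independent[OF vec.independent_mono[OF E(3) F(2)]] F(3) by simp
  qed
qed

section \<open>Points and lines as spans of vectors\<close>

lemma span_pair: "vec.span {u, v} = {x *s u + y *s v | x y. True}"
proof -
  have "x \<in> vec.span {u, v} \<longleftrightarrow> (\<exists>a b. x = b *s v + a *s u)" for x
    by (simp add: vec.span_insert[of u] vec.span_singleton image_iff diff_eq_eq)
  then show ?thesis
    by (simp add: set_eq_iff add.commute)
qed

lemma span_singleton_eq:
  fixes u v :: "'k::field ^ 'n"
  assumes "v \<in> vec.span {u}" "v \<noteq> 0"
  shows "vec.span {v} = vec.span {u}"
proof -
  obtain k where k: "v = k *s u"
    using assms(1) by (auto simp: vec.span_singleton)
  then have "k \<noteq> 0"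
    using assms(2) by auto
  then have "u = (1 / k) *s v"
    using k by simp
  then have "u \<in> vec.span {v}"
    by (metis vec.span_base vec.span_scale singletonI)
  then show ?thesis
    using assms(1) by (simp add: vec.span_eq)
qed

lemma point_generator:
  fixes P :: "('k::field ^ 'n) set"
  assumes "vec.subspace P" "vec.dim P = 1"
  obtains w where "w \<noteq> 0" "P = vec.span {w}"
proof -
  obtain D where D: "D \<subseteq> P" "vec.independent D" "P \<subseteq> vec.span D" "card D = 1"
    using vec.basis_exists[of P] assms(2) by metis
  then obtain w where w: "D = {w}"
    by (auto simp: card_1_singleton_iff)
  have "w \<noteq> 0"
    using D(2) vec.dependent_zero[of D] w by auto
  moreover have "P = vec.span {w}"
    using D w assms(1) by (metis vec.span_minimal subset_antisym)
  ultimately show thesis ..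
qed

lemma line_through_points:
  fixes L :: "('k::field ^ 'n) set"
  assumes L: "vec.subspace L" "vec.dim L = 2" and uv: "u \<in> L" "v \<in> L" "u \<noteq> 0" "v \<noteq> 0"
    and neq: "vec.span {u} \<noteq> vec.span {v}"
  shows "L = vec.span {u, v}"
proof -
  have "v \<notin> vec.span {u}"
    using span_singleton_eq[of v u] uv neq by auto
  then have ind: "vec.independent {v, u}" and "u \<noteq> v"
    using uv by (auto simp: vec.independent_insert vec.span_base)
  have "vec.dim (vec.span {v, u}) = 2"
    using vec.dim_span_eq_card_independent[OF ind] \<open>u \<noteq> v\<close> by simp
  then have "vec.span {v, u} = L"
    using L uv by (intro vec.subspace_dim_equal vec.subspace_span vec.span_minimal) auto
  then show ?thesis
    by (simp add: insert_commute)
qed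

text \<open>
  If one coefficient vanished, the third point would coincide with one of the first two.
\<close>

lemma third_point_on_line:
  fixes L :: "('k::field ^ 'n) set"
  assumes L: "vec.subspace L" "vec.dim L = 2"
    and mem: "u \<in> L" "v \<in> L" "w \<in> L" and nz: "u \<noteq> 0" "v \<noteq> 0" "w \<noteq> 0"
    and neq: "vec.span {u} \<noteq> vec.span {v}" "vec.span {w} \<noteq> vec.span {u}" "vec.span {w} \<noteq> vec.span {v}"
  shows "\<exists>x y. x \<noteq> 0 \<and> y \<noteq> 0 \<and> w = x *s u + y *s v"
proof -
  have "L = vec.span {u, v}"
    by (rule line_through_points) fact+
  then obtain x y where w: "w = x *s u + y *s v"
    using \<open>w \<in> L\<close> unfolding span_pair by blast
  have "w \<in> vec.span {v}" if "x = 0"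
    using w that by (auto simp: vec.span_singleton)
  moreover have "w \<in> vec.span {u}" if "y = 0"
    using w that by (auto simp: vec.span_singleton)
  ultimately have "x \<noteq> 0 \<and> y \<noteq> 0"
    using span_singleton_eq[of w] neq nz(3) by blast
  with w show ?thesis by blast
qed

section \<open>The Cremona--Richmond configuration\<close>

definition cr_vec :: "6 set \<Rightarrow> 'k::field_char_0 ^ 6" where
  "cr_vec I = (\<chi> k. if k \<in> I then 2 else -1)"

lemma sum_two_valued:
  fixes I :: "6 set" and p q :: "'k::field_char_0"
  assumes "card I = 2"
  shows "(\<Sum>k\<in>UNIV. if k \<in> I then p else q) = 2 * p + 4 * q"
proof -
  have "card (- I) = 4"
    using assms by (simp add: Compl_eq_Diff_UNIV card_Diff_subset)
  then show ?thesis
    using assms by (simp add: sum.If_cases Compl_eq)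
qed

lemma cr_vec_sum_zero: "card I = 2 \<Longrightarrow> cr_vec I \<in> sum_zero"
  by (simp add: cr_vec_def sum_zero_def sum_two_valued)

lemma cr_vec_nonzero: "cr_vec I \<noteq> 0"
  by (auto simp: cr_vec_def vec_eq_iff)

text \<open>
  The condition \<open>2 * x + 4 * y = 0\<close> on the two values of a vector of \<^term>\<open>CR_point I\<close> leaves only the
  multiples of \<open>cr_vec I\<close>.
\<close>

lemma CR_point_eq:
  assumes "card I = 2"
  shows "CR_point I = (vec.span {cr_vec I} :: ('a::field_char_0 ^ 6) set)"
proof
  show "vec.span {cr_vec I} \<subseteq> (CR_point I :: ('a ^ 6) set)"
    using cr_vec_sum_zero[OF assms, where 'a = 'a]
    unfolding vec.span_singleton CR_point_def sum_zero_def cr_vec_def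
    by (auto simp flip: sum_distrib_left)
  show "CR_point I \<subseteq> (vec.span {cr_vec I} :: ('a ^ 6) set)"
  proof
    fix x :: "'a ^ 6" assume x: "x \<in> CR_point I"
    obtain i j where "i \<in> I" "j \<notin> I"
    proof -
      have "I \<noteq> {}" "I \<noteq> UNIV" using assms by auto
      then show thesis using that by blast
    qed
    moreover have "\<forall>i j. (i \<in> I \<and> j \<in> I) \<or> (i \<notin> I \<and> j \<notin> I) \<longrightarrow> x $ i = x $ j"
      using x by (simp add: CR_point_def)
    ultimately have "k \<in> I \<Longrightarrow> x $ k = x $ i" "k \<notin> I \<Longrightarrow> x $ k = x $ j" for k
      by blast+
    then have eq: "x $ k = (if k \<in> I then x $ i else x $ j)" for k
      by presburger
    have "0 = (\<Sum>k\<in>UNIV. x $ k)"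
      using x by (simp add: CR_point_def sum_zero_def)
    also have "\<dots> = 2 * x $ i + 4 * x $ j"
      unfolding sum_two_valued[OF assms, symmetric] by (rule sum.cong[OF refl eq])
    finally have "2 * (x $ i + 2 * x $ j) = 0"
      by (simp add: algebra_simps)
    then have "x $ i + 2 * x $ j = 0"
      unfolding mult_eq_0_iff by (metis zero_neq_numeral)
    then have ij: "x $ i = - 2 * x $ j"
      by (simp add: eq_neg_iff_add_eq_0)
    have "x $ k = ((- x $ j) *s cr_vec I) $ k" for k
      unfolding eq[of k] ij by (simp add: cr_vec_def)
    then have "x = (- x $ j) *s cr_vec I"
      unfolding vec_eq_iff by blast
    then show "x \<in> vec.span {cr_vec I}"
      unfolding vec.span_singleton by (rule range_eqI)
  qed
qed

lemma splittingsE: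
  assumes "S \<in> splittings"
  obtains I J K where "S = {I, J, K}" "card I = 2" "card J = 2" "card K = 2"
    "I \<inter> J = {}" "I \<inter> K = {}" "J \<inter> K = {}" "I \<union> J \<union> K = UNIV"
proof -
  have S: "\<Union>S = UNIV" "disjoint S" "\<forall>I\<in>S. card I = 2"
    using assms by (auto simp: splittings_def partition_on_def)
  have "card (UNIV :: 6 set) = (\<Sum>I\<in>S. card I)"
    using S by (metis card_Union_disjoint finite disjoint_def pairwise_def disjnt_def)
  also have "\<dots> = 2 * card S"
    using S(3) by simp
  finally have "card S = 3" by simp
  then obtain I J K where "S = {I, J, K}" "I \<noteq> J" "I \<noteq> K" "J \<noteq> K"
    by (auto simp: card_3_iff)
  with S show thesis
    by (intro that[of I J K]) (auto simp: disjoint_def)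
qed

lemma UNIV_6_eq: "distinct [i, j, k, l, m, n] \<Longrightarrow> UNIV = {i, j, k, l, m, n :: 6}"
  by (rule sym, rule card_subset_eq) auto

lemma splittingsI:
  assumes "distinct [i, j, k, l, m, n :: 6]"
  shows "{{i, j}, {k, l}, {m, n}} \<in> splittings"
  using assms UNIV_6_eq[OF assms]
  by (auto simp: splittings_def partition_on_def disjoint_def)

lemma cr_vec_sum:
  assumes "I \<inter> J = {}" "I \<inter> K = {}" "J \<inter> K = {}" "I \<union> J \<union> K = UNIV"
  shows "cr_vec I + cr_vec J + cr_vec K = 0"
  using assms by (auto simp: vec_eq_iff cr_vec_def)

text \<open>
  A vector with the values \<open>x\<close>, \<open>y\<close> and \<open>- x - y\<close> on the three duads is solved for explicitly as a
  combination \<open>a * cr_vec I + b * cr_vec J\<close>: the equations \<open>2 * a - b = x\<close> and \<open>2 * b - a = y\<close> have the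
  determinant 3.
\<close>

lemma CR_line_eq:
  assumes IJK: "card I = 2" "card J = 2" "card K = 2"
    "I \<inter> J = {}" "I \<inter> K = {}" "J \<inter> K = {}" "I \<union> J \<union> K = UNIV"
  shows "CR_line {I, J, K} = (vec.span {cr_vec I, cr_vec J} :: ('a::field_char_0 ^ 6) set)"
proof
  have "x *s cr_vec I + y *s cr_vec J \<in> CR_line {I, J, K}" for x y :: 'a
    using IJK cr_vec_sum_zero[of I, where 'a = 'a] cr_vec_sum_zero[of J, where 'a = 'a]
    by (auto simp: CR_line_def sum_zero_def sum.distrib cr_vec_def simp flip: sum_distrib_left)
  then show "vec.span {cr_vec I, cr_vec J} \<subseteq> (CR_line {I, J, K} :: ('a ^ 6) set)"
    unfolding span_pair by blast
  show "CR_line {I, J, K} \<subseteq> (vec.span {cr_vec I, cr_vec J} :: ('a ^ 6) set)"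
  proof
    fix x :: "'a ^ 6" assume x: "x \<in> CR_line {I, J, K}"
    obtain i j k where "i \<in> I" "j \<in> J" "k \<in> K"
      using IJK by (metis card.empty ex_in_conv zero_neq_numeral)
    moreover have "\<forall>A\<in>{I, J, K}. \<forall>i\<in>A. \<forall>j\<in>A. x $ i = x $ j"
      using x unfolding CR_line_def mem_Collect_eq by blast
    ultimately have eq: "\<And>m. m \<in> I \<Longrightarrow> x $ m = x $ i" "\<And>m. m \<in> J \<Longrightarrow> x $ m = x $ j"
        "\<And>m. m \<in> K \<Longrightarrow> x $ m = x $ k"
      by blast+
    have sums: "(\<Sum>m\<in>A. x $ m) = 2 * x $ a" if "card A = 2" "\<And>m. m \<in> A \<Longrightarrow> x $ m = x $ a" for A a
    proof -
      have "(\<Sum>m\<in>A. x $ m) = (\<Sum>m\<in>A. x $ a)"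
        by (rule sum.cong[OF refl that(2)])
      then show ?thesis
        using that(1) by simp
    qed
    have "0 = (\<Sum>m\<in>UNIV. x $ m)"
      using x by (simp add: CR_line_def sum_zero_def)
    also have "\<dots> = 2 * x $ i + 2 * x $ j + 2 * x $ k"
      using IJK(4-6) sums[OF IJK(1) eq(1)] sums[OF IJK(2) eq(2)] sums[OF IJK(3) eq(3)]
      unfolding IJK(7)[symmetric] by (simp add: sum.union_disjoint Int_Un_distrib2)
    finally have "2 * (x $ i + x $ j + x $ k) = 0" by (simp add: algebra_simps)
    then have "x $ i + x $ j + x $ k = 0"
      unfolding mult_eq_0_iff by (metis zero_neq_numeral)
    then have k: "x $ k = - x $ i - x $ j" by (simp add: algebra_simps eq_neg_iff_add_eq_0)
    define a b where "a = (2 * x $ i + x $ j) / 3" and "b = (x $ i + 2 * x $ j) / 3"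
    have ab: "x $ i = a * 2 - b" "x $ j = b * 2 - a" "x $ k = - a - b"
      unfolding k a_def b_def by (simp_all add: field_simps)
    have "x = a *s cr_vec I + b *s cr_vec J"
    proof (subst vec_eq_iff, rule allI)
      fix m
      consider "m \<in> I" "m \<notin> J" | "m \<in> J" "m \<notin> I" | "m \<in> K" "m \<notin> I" "m \<notin> J"
        using IJK by blast
      then show "x $ m = (a *s cr_vec I + b *s cr_vec J) $ m"
        using eq[of m] by cases (simp_all add: ab cr_vec_def)
    qed
    then show "x \<in> vec.span {cr_vec I, cr_vec J}"
      unfolding span_pair by blast
  qed
qed

lemma CR_point_inj:
  assumes "card I = 2" "card J = 2" "CR_point I = (CR_point J :: ('k::field_char_0 ^ 6) set)"
  shows "I = J"
proof -
  have "cr_vec I \<in> vec.span {cr_vec J :: 'k ^ 6}"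
    using assms CR_point_eq by (metis vec.span_base insertI1)
  then obtain c :: 'k where c: "cr_vec I = c *s cr_vec J"
    by (auto simp: vec.span_singleton)
  have "c \<noteq> - 2"
  proof
    assume "c = - 2"
    then have "k \<notin> J" for k
      using c[unfolded vec_eq_iff, rule_format, of k] by (auto simp: cr_vec_def split: if_splits)
    then have "J = {}" by blast
    with assms show False by simp
  qed
  then have "- c \<noteq> 2"
    by (metis minus_equation_iff)
  then have "k \<in> I \<Longrightarrow> k \<in> J" for k
    using c[unfolded vec_eq_iff, rule_format, of k] by (auto simp: cr_vec_def split: if_splits)
  then show ?thesis
    using assms by (metis card_subset_eq finite subsetI)
qed

lemma CR_incidence:
  assumes "S \<in> splittings" "I \<in> S"
  shows "CR_point I \<subseteq> CR_line S"
proof -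
  have "i \<in> I \<and> j \<in> I \<or> i \<notin> I \<and> j \<notin> I" if "A \<in> S" "i \<in> A" "j \<in> A" for A i j
  proof (cases "A = I")
    case False
    then have "A \<inter> I = {}"
      using assms that by (auto simp: splittings_def partition_on_def disjoint_def)
    then show ?thesis using that by blast
  qed (use that in blast)
  then show ?thesis
    unfolding CR_point_def CR_line_def by blast
qed

lemma cr_vec_sum_distinct:
  assumes "distinct [i, j, k, l, m, n]"
  shows "cr_vec {i, j} + cr_vec {k, l} + cr_vec {m, n} = 0"
  using assms UNIV_6_eq[OF assms] by (intro cr_vec_sum) auto

text \<open>
  The differences \<open>cr_vec {i, m} - cr_vec {0, m}\<close> are three times the differences of unit vectors,
  which span the hyperplane.
\<close>

lemma cr_vec_spans: "vec.span (cr_vec ` {I. card I = 2}) = (sum_zero :: ('k::field_char_0 ^ 6) set)" (is "?U = _")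
proof
  have "vec.subspace (sum_zero :: ('k ^ 6) set)"
    by (rule subspace_sum_zero)
  then show "?U \<subseteq> sum_zero"
    by (intro vec.span_minimal) (auto intro: cr_vec_sum_zero)
  have e: "axis i 1 - axis 0 1 \<in> ?U" for i :: 6
  proof (cases "i = 0")
    case True
    then show ?thesis by (simp add: vec.span_zero)
  next
    case False
    have "card {i, 0} \<noteq> card (UNIV :: 6 set)"
      using False by simp
    then have "{i, 0} \<noteq> UNIV"
      by metis
    then obtain m where m: "m \<noteq> i" "m \<noteq> 0"
      by blast
    have "axis i 1 - axis 0 1 = (1 / 3) *s (cr_vec {i, m} - cr_vec {0, m} :: 'k ^ 6)"
      using False m by (auto simp: vec_eq_iff axis_def cr_vec_def)
    also have "\<dots> \<in> ?U"
      using m by (intro vec.span_scale vec.span_diff vec.span_base imageI) auto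
    finally show ?thesis .
  qed
  show "sum_zero \<subseteq> ?U"
  proof
    fix x :: "'k ^ 6" assume "x \<in> sum_zero"
    then have "(\<Sum>i\<in>UNIV. x $ i) = 0"
      by (simp add: sum_zero_def)
    then have "(\<Sum>i\<in>UNIV. x $ i *s (axis i 1 - axis 0 1)) = x"
      by (simp add: vec.scale_right_diff_distrib sum_subtractf basis_expansion flip: vec.scale_sum_left)
    moreover have "(\<Sum>i\<in>UNIV. x $ i *s (axis i 1 - axis 0 1)) \<in> ?U"
      by (intro vec.span_sum vec.span_scale e)
    ultimately show "x \<in> ?U"
      by simp
  qed
qed

section \<open>The normal form of the pentagon\<close>

lemma independent_family_5:
  fixes a :: "5 \<Rightarrow> 'k::field ^ 'n"
  assumes ind: "vec.independent (range a)" and inj: "inj a"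
    and eq: "x0 *s a j + x1 *s a (j + 1) + x2 *s a (j + 2) + x3 *s a (j + 3) + x4 *s a (j + 4) = 0"
  shows "x0 = 0 \<and> x1 = 0 \<and> x2 = 0 \<and> x3 = 0 \<and> x4 = 0"
proof -
  define x where "x i = (if i = j then x0 else if i = j + 1 then x1 else if i = j + 2 then x2
    else if i = j + 3 then x3 else x4)" for i
  have x: "x j = x0" "x (j + 1) = x1" "x (j + 2) = x2" "x (j + 3) = x3" "x (j + 4) = x4"
    by (simp_all add: x_def)
  have "(\<Sum>v\<in>range a. x (inv a v) *s v) = (\<Sum>i\<in>UNIV. x i *s a i)"
    by (simp add: sum.reindex[OF inj] inv_f_f[OF inj])
  also have "\<dots> = 0"
    unfolding sum_5_shift[of _ j] x by (rule eq)
  finally have "x (inv a v) = 0" if "v \<in> range a" for v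
    using vec.independentD[OF ind, of "range a" "\<lambda>v. x (inv a v)"] that by simp
  then have "x i = 0" for i
    using inv_f_f[OF inj] by (metis rangeI)
  then show ?thesis
    using x by metis
qed

text \<open>
  Cyclic one-cocycles with trivial product are coboundaries. This is what makes the product of the \<open>G j\<close>
  the only invariant of the configuration under rescaling.
\<close>

lemma cyclic_scaling:
  fixes g :: "5 \<Rightarrow> 'k::field"
  assumes "g 0 * g 1 * g 2 * g 3 * g 4 = 1"
  obtains \<nu> where "\<And>j. \<nu> j \<noteq> 0" "\<And>j. \<nu> (j + 1) = g j * \<nu> j"
proof
  define \<nu> where "\<nu> j = (if j = 0 then 1 else if j = 1 then g 0 else if j = 2 then g 0 * g 1
    else if j = 3 then g 0 * g 1 * g 2 else g 0 * g 1 * g 2 * g 3)" for j :: 5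
  show "\<nu> j \<noteq> 0" for j
    using assms by (auto simp: \<nu>_def)
  show "\<nu> (j + 1) = g j * \<nu> j" for j
    using exhaust_5[of j] assms by (elim disjE) (simp_all add: \<nu>_def mult_ac)
qed

text \<open>
  The lines through two diagonals. Both sides of \<open>b (j + 3) = \<kappa> j * c j + l j * c (j + 1)\<close> are expanded
  in the basis \<open>a\<close>: the coefficients of \<open>a (j + 2)\<close> and \<open>a (j + 3)\<close> must cancel on the right, which
  determines \<open>B j\<close>, and the ratio of the other two, at \<open>a (j + 1)\<close> and \<open>a (j + 4)\<close>, determines \<open>B (j + 3)\<close>.
  \<open>B\<close> and \<open>G\<close> are the coefficients after \<open>b j\<close> and \<open>c j\<close> are scaled to have coefficient 1 at
  \<open>a (j + 1)\<close>.
\<close>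

lemma pentagon_cocycle:
  fixes a :: "5 \<Rightarrow> 'k::field ^ 'n"
  assumes ind: "vec.independent (range a)" "inj a"
    and nz: "\<And>j. \<alpha> j \<noteq> 0" "\<And>j. \<beta> j \<noteq> 0" "\<And>j. \<delta> j \<noteq> 0" "\<And>j. \<gamma> j \<noteq> 0" "\<And>j. \<kappa> j \<noteq> 0" "\<And>j. l j \<noteq> 0"
    and b: "\<And>j. b j = \<alpha> j *s a (j + 1) + \<beta> j *s a (j + 3)"
    and c: "\<And>j. c j = \<delta> j *s b j + \<gamma> j *s a (j + 2)"
    and bc: "\<And>j. b (j + 3) = \<kappa> j *s c j + l j *s c (j + 1)"
  defines "B \<equiv> \<lambda>j. \<beta> j / \<alpha> j" and "G \<equiv> \<lambda>j. \<gamma> j / (\<delta> j * \<alpha> j)"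
  shows "B j = G j * G (j + 1)" and "G j * B (j + 1) * B (j + 3) = - 1"
proof -
  have "0 *s a j + (\<kappa> j * \<delta> j * \<alpha> j - \<beta> (j + 3)) *s a (j + 1)
      + (\<kappa> j * \<gamma> j + l j * \<delta> (j + 1) * \<alpha> (j + 1)) *s a (j + 2)
      + (\<kappa> j * \<delta> j * \<beta> j + l j * \<gamma> (j + 1)) *s a (j + 3)
      + (l j * \<delta> (j + 1) * \<beta> (j + 1) - \<alpha> (j + 3)) *s a (j + 4) = \<kappa> j *s c j + l j *s c (j + 1) - b (j + 3)"
    unfolding c b cyclic_5_simps by (simp add: vec_eq_iff algebra_simps)
  also have "\<dots> = 0"
    using bc[of j] by simp
  finally have "0 = (0::'k) \<and> \<kappa> j * \<delta> j * \<alpha> j - \<beta> (j + 3) = 0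
      \<and> \<kappa> j * \<gamma> j + l j * \<delta> (j + 1) * \<alpha> (j + 1) = 0
      \<and> \<kappa> j * \<delta> j * \<beta> j + l j * \<gamma> (j + 1) = 0
      \<and> l j * \<delta> (j + 1) * \<beta> (j + 1) - \<alpha> (j + 3) = 0"
    by (rule independent_family_5[OF ind])
  then have eqs: "\<beta> (j + 3) = \<kappa> j * \<delta> j * \<alpha> j" "\<kappa> j * \<gamma> j = - (l j * \<delta> (j + 1) * \<alpha> (j + 1))"
      "\<kappa> j * \<delta> j * \<beta> j = - (l j * \<gamma> (j + 1))" "\<alpha> (j + 3) = l j * \<delta> (j + 1) * \<beta> (j + 1)"
    by (simp_all add: eq_neg_iff_add_eq_0)
  have "\<kappa> j * (\<beta> j * \<delta> j * \<delta> (j + 1) * \<alpha> (j + 1)) = (\<kappa> j * \<delta> j * \<beta> j) * (\<delta> (j + 1) * \<alpha> (j + 1))"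
    by (simp add: mult_ac)
  also have "\<dots> = - (l j * \<delta> (j + 1) * \<alpha> (j + 1)) * \<gamma> (j + 1)"
    unfolding eqs by (simp add: mult_ac)
  also have "\<dots> = \<kappa> j * (\<gamma> j * \<gamma> (j + 1))"
    unfolding eqs(2)[symmetric] by (simp add: mult_ac)
  finally have "\<beta> j * \<delta> j * \<delta> (j + 1) * \<alpha> (j + 1) = \<gamma> j * \<gamma> (j + 1)"
    using nz by simp
  then show "B j = G j * G (j + 1)"
    using nz by (simp add: B_def G_def field_simps)
  have "G j * B (j + 1) * B (j + 3) = \<kappa> j * \<gamma> j / (l j * \<delta> (j + 1) * \<alpha> (j + 1))"
    unfolding B_def G_def eqs(1,4) using nz by (simp add: field_simps)
  also have "\<dots> = - 1"
    unfolding eqs(2) using nz by simp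
  finally show "G j * B (j + 1) * B (j + 3) = - 1" .
qed

text \<open>
  With the relation \<open>\<nu> (j + 2) = - G j * \<nu> (j + 1)\<close> between the scalars, every \<open>G j\<close> becomes -1
  in the basis \<open>\<nu> j * a j\<close>; then \<open>B j = G j * G (j + 1)\<close> becomes 1. The scalars exist because the
  product of the \<open>- G j\<close> around the cycle is 1.
\<close>

lemma pentagon_normal_form:
  fixes a b c :: "5 \<Rightarrow> 'k::field ^ 'n"
  assumes ind: "vec.independent (range a)" "inj a"
    and b: "\<And>j. \<exists>x y. x \<noteq> 0 \<and> y \<noteq> 0 \<and> b j = x *s a (j + 1) + y *s a (j + 3)"
    and c: "\<And>j. \<exists>x y. x \<noteq> 0 \<and> y \<noteq> 0 \<and> c j = x *s b j + y *s a (j + 2)"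
    and bc: "\<And>j. \<exists>x y. x \<noteq> 0 \<and> y \<noteq> 0 \<and> b (j + 3) = x *s c j + y *s c (j + 1)"
  obtains \<nu> s t where "\<And>j. \<nu> j \<noteq> 0" "\<And>j. s j \<noteq> 0" "\<And>j. t j \<noteq> 0"
    "\<And>j. b j = s j *s (\<nu> (j + 1) *s a (j + 1) + \<nu> (j + 3) *s a (j + 3))"
    "\<And>j. c j = t j *s (\<nu> (j + 1) *s a (j + 1) - \<nu> (j + 2) *s a (j + 2) + \<nu> (j + 3) *s a (j + 3))"
proof -
  obtain \<alpha> \<beta> where \<alpha>: "\<And>j. \<alpha> j \<noteq> 0" and \<beta>: "\<And>j. \<beta> j \<noteq> 0"
      and b': "\<And>j. b j = \<alpha> j *s a (j + 1) + \<beta> j *s a (j + 3)"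
    using b by metis
  obtain \<delta> \<gamma> where \<delta>: "\<And>j. \<delta> j \<noteq> 0" and \<gamma>: "\<And>j. \<gamma> j \<noteq> 0"
      and c': "\<And>j. c j = \<delta> j *s b j + \<gamma> j *s a (j + 2)"
    using c by metis
  obtain \<kappa> l where \<kappa>: "\<And>j. \<kappa> j \<noteq> 0" and l: "\<And>j. l j \<noteq> 0"
      and bc': "\<And>j. b (j + 3) = \<kappa> j *s c j + l j *s c (j + 1)"
    using bc by metis
  define B where "B j = \<beta> j / \<alpha> j" for j
  define G where "G j = \<gamma> j / (\<delta> j * \<alpha> j)" for j
  have BG: "B j = G j * G (j + 1)" and GBB: "G j * B (j + 1) * B (j + 3) = - 1" for j
    using pentagon_cocycle[OF ind \<alpha> \<beta> \<delta> \<gamma> \<kappa> l b' c' bc', of j] by (simp_all add: B_def G_def)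
  \<comment> \<open>All \<open>B\<close> are eliminated from one relation; the five instances of it give the same product.\<close>
  have prod: "G 0 * G 1 * G 2 * G 3 * G 4 = - 1"
    using GBB[of 0] BG[of 1] BG[of 3] by (simp add: mult_ac)
  have "- G (0 + 4) * - G (1 + 4) * - G (2 + 4) * - G (3 + 4) * - G (4 + 4) = 1"
  proof -
    have "(0::5) + 4 = 4" "(1::5) + 4 = 0" "(2::5) + 4 = 1" "(3::5) + 4 = 2" "(4::5) + 4 = 3"
      by simp_all
    moreover have "- G 4 * - G 0 * - G 1 * - G 2 * - G 3 = 1"
      using prod by (simp add: mult_ac)
    ultimately show ?thesis
      by (simp only:)
  qed
  then obtain \<nu> where \<nu>: "\<And>j. \<nu> j \<noteq> 0" "\<And>j. \<nu> (j + 1) = - G (j + 4) * \<nu> j"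
    by (rule cyclic_scaling[of "\<lambda>j. - G (j + 4)"]) blast
  have \<nu>2: "\<nu> (j + 2) = - G j * \<nu> (j + 1)" for j
    using \<nu>(2)[of "j + 1"] by (simp only: cyclic_5_simps)
  have \<nu>3: "\<nu> (j + 3) = B j * \<nu> (j + 1)" for j
    using \<nu>2[of "j + 1"] \<nu>2[of j] by (simp add: add.assoc BG)
  define s where "s j = \<alpha> j / \<nu> (j + 1)" for j
  show thesis
  proof
    show "\<nu> j \<noteq> 0" "s j \<noteq> 0" "\<delta> j * s j \<noteq> 0" for j
      using \<nu>(1) \<alpha> \<delta> by (auto simp: s_def)
    show beq: "b j = s j *s (\<nu> (j + 1) *s a (j + 1) + \<nu> (j + 3) *s a (j + 3))" for j
      unfolding b' \<nu>3 s_def B_def using \<nu>(1)[of "j + 1"] \<alpha>[of j] by (simp add: vec_eq_iff field_simps)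
    have "\<gamma> j = - (\<delta> j * s j * \<nu> (j + 2))" for j
      unfolding \<nu>2 s_def G_def using \<nu>(1)[of "j + 1"] \<alpha>[of j] \<delta>[of j] by (simp add: field_simps)
    then show "c j = (\<delta> j * s j) *s (\<nu> (j + 1) *s a (j + 1) - \<nu> (j + 2) *s a (j + 2) + \<nu> (j + 3) *s a (j + 3))" for j
      unfolding c' beq by (simp add: vec_eq_iff algebra_simps)
  qed
qed

section \<open>Labelling the duads by a pentagon\<close>

text \<open>
  Collinearity on each line together with distinctness of its three points: for three nonzero vectors on a
  line, of which the first two are independent, both coefficients of the third are nonzero exactly when the
  three projective points are distinct.
\<close>

definition collinear_triples :: "(6 set \<Rightarrow> 'k::field ^ 6) \<Rightarrow> bool" where
  "collinear_triples w \<longleftrightarrow> (\<forall>i j k l m n. distinct [i, j, k, l, m, n] \<longrightarrow>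
    (\<exists>x y. x \<noteq> 0 \<and> y \<noteq> 0 \<and> w {m, n} = x *s w {i, j} + y *s w {k, l}))"

lemma collinear_triplesD:
  assumes "collinear_triples w" "distinct [i, j, k, l, m, n]"
  shows "\<exists>x y. x \<noteq> 0 \<and> y \<noteq> 0 \<and> w {m, n} = x *s w {i, j} + y *s w {k, l}"
  using assms unfolding collinear_triples_def by blast

definition pentagon :: "(5 \<Rightarrow> 6) \<Rightarrow> 6 \<Rightarrow> bool" where
  "pentagon p z \<longleftrightarrow> inj p \<and> z \<notin> range p"

lemma pentagon_exists: obtains p z where "pentagon p z"
proof -
  obtain p :: "5 \<Rightarrow> 6" where p: "inj p"
    using card_le_inj[of "UNIV :: 5 set" "UNIV :: 6 set"] by auto
  then have "card (range p) = 5"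
    by (simp add: card_image)
  then have "range p \<noteq> UNIV"
    by auto
  then show thesis
    using that p by (auto simp: pentagon_def)
qed

lemma pentagon_distinct:
  assumes "pentagon p z"
  shows "p (j + x) = p (j + y) \<longleftrightarrow> x = y" "p j = p (j + y) \<longleftrightarrow> y = 0" "p (j + y) = p j \<longleftrightarrow> y = 0"
    "p i \<noteq> z" "z \<noteq> p i"
  using assms by (auto simp: pentagon_def inj_eq)

text \<open>
  The orbits of the rotation on duads are told apart by the difference of the two indices: 1 and 4 give
  a side, 2 and 3 a diagonal.
\<close>

lemma duad_cases:
  assumes p: "pentagon p z" and "card I = 2"
  obtains j where "I = {p j, p (j + 1)}" | j where "I = {p j, z}" | j where "I = {p (j + 1), p (j + 4)}"
proof -
  have "card (insert z (range p)) = 6"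
    using p by (simp add: pentagon_def card_image)
  then have "insert z (range p) = UNIV"
    by (intro card_subset_eq) simp_all
  then have cover: "x = z \<or> (\<exists>i. x = p i)" for x
    by blast
  obtain x y where I: "I = {x, y}" "x \<noteq> y"
    using \<open>card I = 2\<close> by (auto simp: card_2_iff)
  show thesis
  proof (cases "x = z \<or> y = z")
    case True
    then obtain j where "I = {p j, z}"
      using I cover by (metis insert_commute)
    then show ?thesis by (rule that(2))
  next
    case False
    then obtain i k where ik: "x = p i" "y = p k"
      using cover by blast
    define d where "d = k - i"
    have k: "k = i + d" by (simp add: d_def)
    have "d \<noteq> 0" using I ik k by auto
    then consider "d = 1" | "d = 2" | "d = 3" | "d = 4"
      using exhaust_5[of d] by blast
    then show ?thesis
    proof cases
      case 1
      then show ?thesis using that(1)[of i] I ik k by simp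
    next
      case 2
      then show ?thesis using that(3)[of "i + 1"] I ik k by (simp only: cyclic_5_simps) (simp add: insert_commute)
    next
      case 3
      then show ?thesis using that(3)[of "i + 4"] I ik k by (simp only: cyclic_5_simps)
    next
      case 4
      then show ?thesis using that(1)[of "i + 4"] I ik k by (simp only: cyclic_5_simps) (simp add: insert_commute)
    qed
  qed
qed

context
  fixes p :: "5 \<Rightarrow> 6" and z :: 6 and w :: "6 set \<Rightarrow> 'k::field ^ 6"
  assumes p: "pentagon p z" and w: "collinear_triples w"
begin

text \<open>
  The three orbits of lines. The third line is the one that closes up the pentagon: it relates points
  that were already expressed through the sides by the other two.
\<close>

lemma side_side_spoke: "\<exists>x y. x \<noteq> 0 \<and> y \<noteq> 0 \<and>
    w {p j, z} = x *s w {p (j + 1), p (j + 1 + 1)} + y *s w {p (j + 3), p (j + 3 + 1)}"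
  by (rule collinear_triplesD[OF w]) (simp add: pentagon_distinct[OF p] add.assoc)

lemma spoke_side_diagonal: "\<exists>x y. x \<noteq> 0 \<and> y \<noteq> 0 \<and>
    w {p (j + 1), p (j + 4)} = x *s w {p j, z} + y *s w {p (j + 2), p (j + 2 + 1)}"
  by (rule collinear_triplesD[OF w]) (simp add: pentagon_distinct[OF p] add.assoc)

lemma diagonal_diagonal_spoke: "\<exists>x y. x \<noteq> 0 \<and> y \<noteq> 0 \<and>
    w {p (j + 3), z} = x *s w {p (j + 1), p (j + 4)} + y *s w {p (j + 1 + 1), p (j + 1 + 4)}"
  by (rule collinear_triplesD[OF w]) (simp add: pentagon_distinct[OF p] add.assoc)

text \<open>
  Two sides give a spoke, and a spoke and a side give a diagonal.
\<close>

lemma pentagon_spans: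
  assumes "card I = 2"
  shows "w I \<in> vec.span (range (\<lambda>j. w {p j, p (j + 1)}))" (is "_ \<in> ?U")
proof -
  have a: "w {p j, p (j + 1)} \<in> ?U" for j
    by (rule vec.span_base) blast
  have b: "w {p j, z} \<in> ?U" for j
  proof -
    obtain x y where "w {p j, z} = x *s w {p (j + 1), p (j + 1 + 1)} + y *s w {p (j + 3), p (j + 3 + 1)}"
      using side_side_spoke by blast
    then show ?thesis
      by (simp only:) (intro vec.span_add vec.span_scale a)
  qed
  have c: "w {p (j + 1), p (j + 4)} \<in> ?U" for j
  proof -
    obtain x y where "w {p (j + 1), p (j + 4)} = x *s w {p j, z} + y *s w {p (j + 2), p (j + 2 + 1)}"
      using spoke_side_diagonal by blast
    then show ?thesis
      by (simp only:) (intro vec.span_add vec.span_scale a b)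
  qed
  show ?thesis
    using p assms by (rule duad_cases) (auto intro: a b c)
qed

end

section \<open>Uniqueness of the configuration\<close>

text \<open>
  The linear map sends the rescaled sides \<open>\<nu> j * a j\<close> to the vectors of the sides in the model. The
  spokes and diagonals then follow since their normal forms are the combinations
  \<open>v (j + 1) + v (j + 3) = - cr_vec {p j, z}\<close> and
  \<open>v (j + 1) - v (j + 2) + v (j + 3) = cr_vec {p (j + 1), p (j + 4)}\<close>, both consequences of the vectors
  of each line of the model summing to zero.
\<close>

proposition collinear_triples_normal_form:
  fixes w :: "6 set \<Rightarrow> 'k::field_char_0 ^ 6"
  assumes w: "collinear_triples w"
    and span: "vec.span (w ` {I. card I = 2}) = sum_zero"
  obtains f where "Vector_Spaces.linear (*s) (*s) f" "bij_betw f sum_zero sum_zero"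
    "\<And>I. card I = 2 \<Longrightarrow> \<exists>s. s \<noteq> 0 \<and> f (w I) = s *s cr_vec I"
proof -
  obtain p z where p: "pentagon p z"
    by (rule pentagon_exists)
  define a where "a j = w {p j, p (j + 1)}" for j
  define b where "b j = w {p j, z}" for j
  define c where "c j = w {p (j + 1), p (j + 4)}" for j
  define v where "v j = (cr_vec {p j, p (j + 1)} :: 'k ^ 6)" for j
  have "w I \<in> vec.span (range a)" if "card I = 2" for I
    using pentagon_spans[OF p w that] by (simp add: a_def[abs_def])
  then have "sum_zero \<subseteq> vec.span (range a)"
    unfolding span[symmetric] by (intro vec.span_minimal) auto
  moreover have "range a \<subseteq> w ` {I. card I = 2}"
    using p by (auto simp: a_def pentagon_def inj_eq intro!: imageI)
  then have "vec.span (range a) \<subseteq> sum_zero"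
    unfolding span[symmetric] by (rule vec.span_mono)
  ultimately have span_a: "vec.span (range a) = sum_zero"
    by blast
  note ind = spanning_family_5[OF span_a]
  have B: "\<exists>x y. x \<noteq> 0 \<and> y \<noteq> 0 \<and> b j = x *s a (j + 1) + y *s a (j + 3)"
    and C: "\<exists>x y. x \<noteq> 0 \<and> y \<noteq> 0 \<and> c j = x *s b j + y *s a (j + 2)"
    and BC: "\<exists>x y. x \<noteq> 0 \<and> y \<noteq> 0 \<and> b (j + 3) = x *s c j + y *s c (j + 1)" for j
    unfolding a_def b_def c_def by (rule side_side_spoke[OF p w] spoke_side_diagonal[OF p w] diagonal_diagonal_spoke[OF p w])+
  obtain \<nu> s t where nz: "\<And>j. \<nu> j \<noteq> 0" "\<And>j. s j \<noteq> 0" "\<And>j. t j \<noteq> 0"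
    and b: "\<And>j. b j = s j *s (\<nu> (j + 1) *s a (j + 1) + \<nu> (j + 3) *s a (j + 3))"
    and c: "\<And>j. c j = t j *s (\<nu> (j + 1) *s a (j + 1) - \<nu> (j + 2) *s a (j + 2) + \<nu> (j + 3) *s a (j + 3))"
    by (rule pentagon_normal_form[OF ind B C BC]) (rule that, assumption+)
  obtain f where f: "Vector_Spaces.linear (*s) (*s) f"
    and fa: "\<And>x. x \<in> range a \<Longrightarrow> f x = (1 / \<nu> (inv a x)) *s v (inv a x)"
    using vec.linear_independent_extend[OF ind(1), of "\<lambda>x. (1 / \<nu> (inv a x)) *s v (inv a x)"] by blast
  interpret f: Vector_Spaces.linear "(*s)" "(*s)" f
    by (rule f)
  have f_a: "f (a j) = (1 / \<nu> j) *s v j" for j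
    using fa[of "a j"] by (simp add: inv_f_f[OF ind(2)])
  have f_b: "f (b j) = (- s j) *s cr_vec {p j, z}" for j
  proof -
    have "distinct [p (j + 1), p (j + 1 + 1), p (j + 3), p (j + 3 + 1), p j, z]"
      by (simp add: pentagon_distinct[OF p] add.assoc)
    from cr_vec_sum_distinct[OF this, where 'a = 'k]
    have "v (j + 1) + v (j + 3) = - cr_vec {p j, z}"
      by (simp add: v_def eq_neg_iff_add_eq_0)
    moreover have "f (b j) = s j *s (v (j + 1) + v (j + 3))"
      unfolding b f.scale f.add f_a using nz(1) by simp
    ultimately show ?thesis
      by simp
  qed
  have f_c: "f (c j) = t j *s cr_vec {p (j + 1), p (j + 4)}" for j
  proof -
    have "distinct [p (j + 1), p (j + 1 + 1), p (j + 3), p (j + 3 + 1), p j, z]"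
      "distinct [p j, z, p (j + 2), p (j + 2 + 1), p (j + 1), p (j + 4)]"
      by (simp_all add: pentagon_distinct[OF p] add.assoc)
    from this[THEN cr_vec_sum_distinct[where 'a = 'k]]
    have "v (j + 1) - v (j + 2) + v (j + 3) = cr_vec {p (j + 1), p (j + 4)}"
      unfolding v_def by (simp add: algebra_simps add_eq_0_iff)
    moreover have "f (c j) = t j *s (v (j + 1) - v (j + 2) + v (j + 3))"
      unfolding c f.scale f.add f.diff f_a using nz(1) by simp
    ultimately show ?thesis
      by simp
  qed
  have f_w: "\<exists>s. s \<noteq> 0 \<and> f (w I) = s *s cr_vec I" if "card I = 2" for I
    using p that
  proof (rule duad_cases)
    show ?thesis if "I = {p j, p (j + 1)}" for j
      using f_a[of j] nz(1)[of j] that by (auto simp: a_def v_def intro!: exI[of _ "1 / \<nu> j"])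
    show ?thesis if "I = {p j, z}" for j
      using f_b[of j] nz(2)[of j] that by (auto simp: b_def intro!: exI[of _ "- s j"])
    show ?thesis if "I = {p (j + 1), p (j + 4)}" for j
      using f_c[of j] nz(3)[of j] that by (auto simp: c_def)
  qed
  have sub: "vec.subspace (f ` sum_zero)"
    using f.subspace_image subspace_sum_zero by blast
  have f_w_sum_zero: "f (w I) \<in> sum_zero" if "card I = 2" for I
    using f_w[OF that] cr_vec_sum_zero[OF that] by (auto intro: vec.subspace_scale[OF subspace_sum_zero])
  have image: "f ` sum_zero = sum_zero"
  proof
    have "f ` sum_zero = vec.span (f ` w ` {I. card I = 2})"
      unfolding span[symmetric] f.span_image ..
    also have "\<dots> \<subseteq> sum_zero"
      using f_w_sum_zero by (intro vec.span_minimal subspace_sum_zero) auto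
    finally show "f ` sum_zero \<subseteq> sum_zero" .
    have "cr_vec I \<in> f ` sum_zero" if I: "card I = 2" for I
    proof -
      obtain s where s: "s \<noteq> 0" "f (w I) = s *s cr_vec I"
        using f_w[OF I] by blast
      have "w I \<in> sum_zero"
        unfolding span[symmetric] using I by (intro vec.span_base) blast
      then have "(1 / s) *s f (w I) \<in> f ` sum_zero"
        using vec.subspace_scale[OF sub] by blast
      then show ?thesis using s by simp
    qed
    then show "sum_zero \<subseteq> f ` sum_zero"
      unfolding cr_vec_spans[symmetric, where 'k = 'k]
      using sub by (intro vec.span_minimal) (auto simp: cr_vec_spans)
  qed
  have "vec.span (range (f \<circ> a)) = sum_zero"
    unfolding image_comp[symmetric] f.span_image span_a by (rule image)
  from spanning_family_5[OF this] have "inj_on f (vec.span (range a))"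
    by (intro vec.linear_inj_on_span_independent_image[OF f]) (simp_all add: image_comp inj_on_imageI)
  then have "bij_betw f sum_zero sum_zero"
    unfolding span_a bij_betw_def using image by blast
  from f this f_w show thesis
    by (rule that)
qed

lemma intersection_pointD:
  assumes "\<forall>L\<in>C. line_in_P4 L" "P \<in> intersection_points C"
  shows "vec.subspace P" "vec.dim P = 1" "P \<subseteq> sum_zero"
  using assms by (auto simp: intersection_points_def line_in_P4_def intro!: vec.subspace_inter)

theorem theoremA8:
  fixes C :: "('k::{alg_closed_field, field_char_0} ^ 6) set set"
  assumes "\<forall>L\<in>C. line_in_P4 L"
    and "card C = 15"
    and "card (intersection_points C) = 15"
    and "\<not> contained_in_P3 C"
    and "combinatorially_isomorphic C (intersection_points C) CR_lines CR_points"
  shows "projectively_isomorphic C (intersection_points C) CR_lines CR_points"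
proof -
  obtain \<phi> \<psi> where \<phi>: "bij_betw \<phi> C (CR_lines :: ('k ^ 6) set set)"
    and \<psi>: "bij_betw \<psi> (intersection_points C) (CR_points :: ('k ^ 6) set set)"
    and inc: "\<forall>L\<in>C. \<forall>P\<in>intersection_points C. P \<subseteq> L \<longleftrightarrow> \<psi> P \<subseteq> \<phi> L"
    using assms(5) unfolding combinatorially_isomorphic_def by (elim exE conjE) (rule that)
  \<comment> \<open>The combinatorial isomorphism transports the labels of the model: \<open>w I\<close> spans the point sent to \<open>CR_point I\<close>.\<close>
  have "\<forall>I. card I = 2 \<longrightarrow> (\<exists>w. w \<noteq> 0 \<and> vec.span {w} \<in> intersection_points C \<and> \<psi> (vec.span {w}) = CR_point I)"
  proof (intro allI impI)
    fix I :: "6 set" assume "card I = 2"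
    then have "CR_point I \<in> \<psi> ` intersection_points C"
      using \<psi> by (auto simp: bij_betw_def CR_points_def)
    then obtain P where P: "P \<in> intersection_points C" "\<psi> P = CR_point I"
      by force
    obtain w where "w \<noteq> 0" "P = vec.span {w}"
      using point_generator intersection_pointD[OF assms(1) P(1)] by blast
    then show "\<exists>w. w \<noteq> 0 \<and> vec.span {w} \<in> intersection_points C \<and> \<psi> (vec.span {w}) = CR_point I"
      using P by blast
  qed
  then obtain w where nz: "\<And>I. card I = 2 \<Longrightarrow> w I \<noteq> 0"
    and pt: "\<And>I. card I = 2 \<Longrightarrow> vec.span {w I} \<in> intersection_points C"
    and \<psi>w: "\<And>I. card I = 2 \<Longrightarrow> \<psi> (vec.span {w I}) = CR_point I"
    by metis
  have neq: "vec.span {w I} \<noteq> vec.span {w J}" if "card I = 2" "card J = 2" "I \<noteq> J" for I J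
    using that \<psi>w CR_point_inj by metis
  have on_line: "w I \<in> L" if "L \<in> C" "\<phi> L = CR_line S" "S \<in> splittings" "I \<in> S" for L S I
  proof -
    have I: "card I = 2"
      using that by (simp add: splittings_def)
    then have "vec.span {w I} \<subseteq> L"
      using bspec[OF bspec[OF inc that(1)] pt[OF I]] CR_incidence[OF that(3,4)] that(2) \<psi>w by simp
    then show ?thesis
      by (simp add: vec.span_base subset_iff)
  qed
  have "collinear_triples w"
    unfolding collinear_triples_def
  proof (intro allI impI)
    fix i j k l m n :: 6
    assume dist: "distinct [i, j, k, l, m, n]"
    let ?S = "{{i, j}, {k, l}, {m, n}}"
    have S: "?S \<in> splittings"
      using dist by (rule splittingsI)
    then have "CR_line ?S \<in> \<phi> ` C"
      using \<phi> by (auto simp: bij_betw_def CR_lines_def)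
    then obtain L where L: "L \<in> C" "\<phi> L = CR_line ?S"
      by force
    then have "vec.subspace L" "vec.dim L = 2"
      using assms(1) by (auto simp: line_in_P4_def)
    then show "\<exists>x y. x \<noteq> 0 \<and> y \<noteq> 0 \<and> w {m, n} = x *s w {i, j} + y *s w {k, l}"
      using dist by (intro third_point_on_line[of L] on_line[OF L S] nz neq) (auto simp: doubleton_eq_iff)
  qed
  have line: "\<exists>I J K. \<phi> L = CR_line {I, J, K} \<and> card I = 2 \<and> card J = 2 \<and> card K = 2 \<and>
      I \<inter> J = {} \<and> I \<inter> K = {} \<and> J \<inter> K = {} \<and> I \<union> J \<union> K = UNIV \<and> L = vec.span {w I, w J}" if "L \<in> C" for L
  proof -
    have "\<phi> L \<in> CR_lines"
      using \<phi> that by (auto simp: bij_betw_def)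
    then obtain S where S: "S \<in> splittings" "\<phi> L = CR_line S"
      by (auto simp: CR_lines_def)
    from S(1) obtain I J K where IJK: "S = {I, J, K}" "card I = 2" "card J = 2" "card K = 2"
      "I \<inter> J = {}" "I \<inter> K = {}" "J \<inter> K = {}" "I \<union> J \<union> K = UNIV"
      by (rule splittingsE)
    have "I \<noteq> J"
      using IJK by auto
    moreover have "vec.subspace L" "vec.dim L = 2"
      using assms(1) that by (auto simp: line_in_P4_def)
    ultimately have "L = vec.span {w I, w J}"
      using IJK by (intro line_through_points on_line[OF that S(2,1)] nz neq) auto
    then show ?thesis
      using IJK S(2) by blast
  qed
  \<comment> \<open>The points span the whole hyperplane, as each line is spanned by two of them.\<close>
  let ?U = "vec.span (w ` {I. card I = 2})"
  have "?U \<subseteq> sum_zero"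
  proof (intro vec.span_minimal subspace_sum_zero image_subsetI)
    fix I :: "6 set" assume "I \<in> {I. card I = 2}"
    then have "vec.span {w I} \<subseteq> sum_zero"
      using intersection_pointD(3)[OF assms(1) pt] by simp
    then show "w I \<in> sum_zero"
      using vec.span_superset by blast
  qed
  have "L \<subseteq> ?U" if L: "L \<in> C" for L
  proof -
    obtain I J where "card I = 2" "card J = 2" "L = vec.span {w I, w J}"
      using line[OF L] by blast
    then show ?thesis
      by (simp add: vec.span_mono)
  qed
  have "?U = sum_zero"
  proof (rule ccontr)
    assume "?U \<noteq> sum_zero"
    then obtain W where "vec.subspace W" "?U \<subseteq> W" "W \<subseteq> sum_zero" "vec.dim W = 4"
      using subspace_in_hyperplane[OF vec.subspace_span \<open>?U \<subseteq> sum_zero\<close>] by blast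
    then have "contained_in_P3 C"
      unfolding contained_in_P3_def using \<open>\<And>L. L \<in> C \<Longrightarrow> L \<subseteq> ?U\<close> by (meson subset_trans)
    with assms(4) show False
      by blast
  qed
  obtain f where f: "Vector_Spaces.linear (*s) (*s) f"
      "bij_betw f sum_zero sum_zero" "\<And>I. card I = 2 \<Longrightarrow> \<exists>s. s \<noteq> 0 \<and> f (w I) = s *s cr_vec I"
    by (rule collinear_triples_normal_form[OF \<open>collinear_triples w\<close> \<open>?U = sum_zero\<close>]) (rule that, assumption+)
  interpret f: Vector_Spaces.linear "(*s)" "(*s)" f
    by (rule f)
  \<comment> \<open>It suffices that \<open>f\<close> agrees with the combinatorial isomorphism on points and on lines.\<close>
  have f_point: "f ` vec.span {w I} = CR_point I" if "card I = 2" for I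
  proof -
    obtain s where s: "s \<noteq> 0" "f (w I) = s *s cr_vec I"
      using f(3)[OF \<open>card I = 2\<close>] by blast
    then have "f (w I) \<noteq> 0" "f (w I) \<in> vec.span {cr_vec I}"
      using cr_vec_nonzero by (auto intro: vec.span_scale vec.span_base)
    then have "vec.span {f (w I)} = vec.span {cr_vec I}"
      by (intro span_singleton_eq)
    then show ?thesis
      using f.span_image[of "{w I}"] by (simp add: CR_point_eq[OF that])
  qed
  have "f ` P = \<psi> P" if P: "P \<in> intersection_points C" for P
  proof -
    have "\<psi> P \<in> CR_points"
      using \<psi> P by (auto simp: bij_betw_def)
    then obtain I where I: "card I = 2" "\<psi> P = CR_point I"
      by (auto simp: CR_points_def)
    then have "P = vec.span {w I}"
      using \<psi> P pt \<psi>w by (metis bij_betw_def inj_onD)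
    then show ?thesis
      using f_point I by simp
  qed
  then have "(\<lambda>P. f ` P) ` intersection_points C = CR_points"
    using \<psi> by (auto simp: bij_betw_def)
  moreover have "f ` L = \<phi> L" if L: "L \<in> C" for L
  proof -
    obtain I J K where IJK: "\<phi> L = CR_line {I, J, K}" "card I = 2" "card J = 2" "card K = 2"
      "I \<inter> J = {}" "I \<inter> K = {}" "J \<inter> K = {}" "I \<union> J \<union> K = UNIV" "L = vec.span {w I, w J}"
      using line[OF L] by blast
    obtain s t where s: "s \<noteq> 0" "f (w I) = s *s cr_vec I" and t: "t \<noteq> 0" "f (w J) = t *s cr_vec J"
      using f(3) IJK(2,3) by metis
    have "f ` L = vec.span {s *s cr_vec I, t *s cr_vec J}"
      unfolding IJK(9) f.span_image[symmetric] by (simp add: s t)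
    also have "\<dots> = vec.span {cr_vec I, cr_vec J}"
    proof (unfold vec.span_eq, intro conjI)
      show "{s *s cr_vec I, t *s cr_vec J} \<subseteq> vec.span {cr_vec I, cr_vec J}"
        by (auto intro: vec.span_scale vec.span_base)
      have "cr_vec I = (1 / s) *s (s *s cr_vec I)" "cr_vec J = (1 / t) *s (t *s cr_vec J)"
        using s t by simp_all
      then show "{cr_vec I, cr_vec J} \<subseteq> vec.span {s *s cr_vec I, t *s cr_vec J}"
        by (metis vec.span_scale vec.span_base insertI1 insertI2 empty_subsetI insert_subset)
    qed
    also have "\<dots> = \<phi> L"
      unfolding IJK(1) using IJK by (intro CR_line_eq[symmetric])
    finally show ?thesis .
  qed
  then have "(\<lambda>L. f ` L) ` C = CR_lines"
    using \<phi> by (auto simp: bij_betw_def)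
  ultimately show ?thesis
    using f unfolding projectively_isomorphic_def by blast
qed

end
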